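(* Let $G=(V,E)$ be a finite simple connected graph with $|V|=k\ge 2$. Then its blowup-polynomial $p_G(\mathbf n)$ is real-stable in the variables $\{n_v: v\in V\}=\{n_1,\dots,n_k\}$. In particular, the univariate blowup-polynomial $u_G(n)=p_G(n,\dots,n)$ is real-rooted (all its complex roots are real).
   Context: For a finite simple connected graph $H$, its distance matrix $D_H$ is the matrix indexed by $V(H)\times V(H)$ whose $(v,w)$ entry is the length of a shortest path from $v$ to $w$ if $v\ne w$, and $0$ if $v=w$. Given a finite simple connected graph $G=(V,E)$ with $|V|\ge 2$ and positive integers $\mathbf n=\{n_v: v\in V\}$, the blowup graph $G[\mathbf n]$ is the finite simple connected graph having $n_v$ copies of each vertex $v\in V$, in which a copy of $v$ is adjacent to a copy of $w$ if and only if $v\neq w$ and $(v,w)\in E$. The blowup-polynomial of $G$ is the unique polynomial $p_G(\mathbf n)\in\mathbb{Z}[\{n_v: v\in V\}]$ (it is known to exist) such that $\det D_{G[\mathbf n]}=(-2)^{\sum_{v}(n_v-1)}p_G(\mathbf n)$ for all $\mathbf n\in\mathbb{Z}_{>0}^V$; here the $n_v$ are regarded as indeterminates. A polynomial $p(z_1,\dots,z_k)$ with real coefficients is real-stable if $p(z_1,\dots,z_k)\neq 0$ whenever $z_1,\dots,z_k\in\mathbb{C}$ satisfy $\operatorname{Im}(z_j)>0$ for all $j$. *)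

theory Defs
  imports
    "HOL-Library.Poly_Mapping"
    "HOL-Computational_Algebra.Polynomial"
    "HOL-Analysis.Determinants"
    "Graph_Theory.Graph_Theory"
begin

text \<open>
  Finite simple graphs are loop-free symmetric pair digraphs, i.e. the locale predicate
  \<open>pair_graph\<close>: the edge \<open>{u, v}\<close> is represented by the two arcs \<open>(u, v)\<close> and \<open>(v, u)\<close>.
\<close>

text \<open>Length of a shortest path; only meaningful if \<open>v\<close> is reachable from \<open>u\<close>.\<close>

definition graph_dist :: "'a pair_pre_digraph \<Rightarrow> 'a \<Rightarrow> 'a \<Rightarrow> nat" where
  "graph_dist G u v = (LEAST l. \<exists>p. pre_digraph.apath (with_proj G) u p v \<and> length p = l)"

definition distance_matrix :: "'a pair_pre_digraph \<Rightarrow> 'a \<Rightarrow> 'a \<Rightarrow> int" where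
  "distance_matrix G v w = (if v = w then 0 else int (graph_dist G v w))"

text \<open>The copies of \<open>v\<close> are \<open>(v, 0), \<dots>, (v, n v - 1)\<close>.\<close>

definition blowup :: "'a pair_pre_digraph \<Rightarrow> ('a \<Rightarrow> nat) \<Rightarrow> ('a \<times> nat) pair_pre_digraph" where
  "blowup G n =
     \<lparr> pverts = (SIGMA v : pverts G. {..<n v}),
       parcs = {((v, i), (w, j)) | v i w j.
                  v \<noteq> w \<and> (v, w) \<in> parcs G \<and> i < n v \<and> j < n w} \<rparr>"

text \<open>
  Determinant of a square matrix with rows and columns indexed by a finite set \<open>S\<close>: the Leibniz
  formula of the library's \<open>det\<close>, whose index set is a whole type.
\<close>

definition det_on :: "'i set \<Rightarrow> ('i \<Rightarrow> 'i \<Rightarrow> 'r::comm_ring_1) \<Rightarrow> 'r" where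
  "det_on S A = (\<Sum>p | p permutes S. of_int (sign p) * (\<Prod>i\<in>S. A i (p i)))"

lemma det_on_UNIV: "det_on UNIV (\<lambda>i j. A $ i $ j) = det A"
  by (simp add: det_on_def det_def)

text \<open>
  Multivariate polynomials in variables from \<open>'v\<close>: finitely supported maps from monomials, which
  are finitely supported exponent vectors, to coefficients.
\<close>

type_synonym ('v, 'c) mvpoly = "('v \<Rightarrow>\<^sub>0 nat) \<Rightarrow>\<^sub>0 'c"

definition mvpoly_vars :: "('v, 'c::zero) mvpoly \<Rightarrow> 'v set" where
  "mvpoly_vars p = (\<Union>m\<in>Poly_Mapping.keys p. Poly_Mapping.keys m)"

text \<open>Evaluation at \<open>x\<close> with the coefficients mapped into the target ring by \<open>h\<close>.\<close>

definition mvpoly_eval ::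
    "('c::zero \<Rightarrow> 'r::comm_semiring_1) \<Rightarrow> ('v, 'c) mvpoly \<Rightarrow> ('v \<Rightarrow> 'r) \<Rightarrow> 'r" where
  "mvpoly_eval h p x =
     (\<Sum>m\<in>Poly_Mapping.keys p.
        h (Poly_Mapping.lookup p m) * (\<Prod>v\<in>Poly_Mapping.keys m. x v ^ Poly_Mapping.lookup m v))"

text \<open>
  \<open>mvpoly_vars p \<subseteq> pverts G\<close> says that \<open>p\<close> lies in \<open>\<int>[{n\<^sub>v : v \<in> V}]\<close>. The natural-number
  subtraction in the exponent does not truncate, since \<open>n v > 0\<close> on \<open>V\<close>.
\<close>

definition blowup_poly :: "'a pair_pre_digraph \<Rightarrow> ('a, int) mvpoly" where
  "blowup_poly G =
     (THE p. mvpoly_vars p \<subseteq> pverts G \<and>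
        (\<forall>n :: 'a \<Rightarrow> nat. (\<forall>v\<in>pverts G. 0 < n v) \<longrightarrow>
           det_on (pverts (blowup G n)) (distance_matrix (blowup G n)) =
             (-2) ^ (\<Sum>v\<in>pverts G. (n v - 1)) * mvpoly_eval id p (\<lambda>v. int (n v))))"

definition univariate_blowup_poly :: "'a pair_pre_digraph \<Rightarrow> int poly" where
  "univariate_blowup_poly G = mvpoly_eval (\<lambda>c. [:c:]) (blowup_poly G) (\<lambda>_. [:0, 1:])"

definition real_stable :: "'v set \<Rightarrow> ('v, real) mvpoly \<Rightarrow> bool" where
  "real_stable V p \<longleftrightarrow>
     (\<forall>z :: 'v \<Rightarrow> complex. (\<forall>v\<in>V. 0 < Im (z v)) \<longrightarrow> mvpoly_eval complex_of_real p z \<noteq> 0)"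

definition real_rooted :: "real poly \<Rightarrow> bool" where
  "real_rooted p \<longleftrightarrow> (\<forall>z :: complex. poly (map_poly complex_of_real p) z = 0 \<longrightarrow> z \<in> \<real>)"

end

theory Submission
  imports Defs "Jordan_Normal_Form.Determinant"
begin

text \<open>
  Write \<open>D\<close> for the distance matrix of \<open>G\<close> and \<open>M = D + 2 I\<close>. Two distinct copies of the same vertex
  are at distance 2 in a blowup, because they have a common neighbour, and copies of distinct
  vertices are as far apart as the vertices themselves (\<open>distance_matrix_blowup\<close>). So the distance
  matrix of \<open>G[n]\<close> is \<open>-2 I\<close> plus the matrix that repeats the entry \<open>M v w\<close> for all copies of
  \<open>v\<close> and \<open>w\<close>.

  The determinant of \<open>A + c I\<close> is the sum of \<open>c\<close> to the power \<open>|V - S|\<close> times the principal minor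
  of \<open>A\<close> on \<open>S\<close>, over all \<open>S \<subseteq> V\<close> (\<open>det_on_add_scalar\<close>). For the matrix with repeated entries a
  principal minor vanishes as soon as \<open>S\<close> contains two copies of one vertex, and otherwise it is a
  principal minor of \<open>M\<close>, which arises once for each choice of copies. Comparing the two
  expansions gives (\<open>det_on_copies\<close>) that the blowup-polynomial is
  \<open>det (diag(n) M - 2 I)\<close>, a polynomial whose coefficients are the principal minors of \<open>M\<close> up to
  powers of \<open>-2\<close> (\<open>blowup_poly_eq\<close>). Its uniqueness, on which the definition of the
  blowup-polynomial rests, is the fact that an integer polynomial vanishing at all positive integer
  points is zero.

  Let all \<open>z v\<close> lie in the open upper half-plane and suppose that \<open>diag(z) M - 2 I\<close> is singular.
  A kernel vector \<open>x\<close> satisfies \<open>(M x) v = 2 (x v) / z v\<close>, hence \<open>x\<^sup>* M x\<close> is the sum of the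
  numbers \<open>2 |x v|\<^sup>2 / z v\<close>. The left side is real because \<open>M\<close> is real and symmetric, whereas the
  right side has negative imaginary part. This contradiction (\<open>det_on_upper_half_plane_nonzero\<close>) is
  real-stability. Restricting to the diagonal excludes roots of the univariate polynomial in the
  upper half-plane, and complex conjugation excludes those in the lower one.
\<close>

section \<open>Distances as shortest walks\<close>

lemma awalk_length_iff_relpow:
  assumes "pair_wf_digraph G"
  shows "(\<exists>p. pre_digraph.awalk (with_proj G) u p v \<and> length p = l) \<longleftrightarrow>
         u \<in> pverts G \<and> (u, v) \<in> parcs G ^^ l"
proof -
  interpret pair_wf_digraph G by fact
  show ?thesis
  proof (induction l arbitrary: u)
    case 0
    then show ?case by (auto simp: awalk_Nil_iff)
  next
    case (Suc l)
    have "(\<exists>p. awalk u p v \<and> length p = Suc l) \<longleftrightarrow>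
          (\<exists>e p. awalk u (e # p) v \<and> length p = l)"
      by (metis length_Suc_conv)
    also have "\<dots> \<longleftrightarrow>
          (\<exists>e. e \<in> parcs G \<and> u = fst e \<and> (\<exists>p. awalk (snd e) p v \<and> length p = l))"
      by (auto simp: awalk_Cons_iff)
    also have "\<dots> \<longleftrightarrow> (\<exists>w. (u, w) \<in> parcs G \<and> w \<in> pverts G \<and> (w, v) \<in> parcs G ^^ l)"
      unfolding Suc.IH by auto
    also have "\<dots> \<longleftrightarrow> u \<in> pverts G \<and> (u, v) \<in> parcs G ^^ Suc l"
      by (meson relpow_Suc_I2 relpow_Suc_D2 wellformed')
    finally show ?case .
  qed
qed

lemma (in wf_digraph) length_awalk_to_apath_le:
  assumes "awalk u p v"
  shows "length (awalk_to_apath p) \<le> length p"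
  using assms
proof (induct rule: awalk_to_apath_induct)
  case (path p)
  then show ?case by (auto simp: awalk_to_apath.simps)
next
  case (decomp p q r s)
  then have "p = q @ r @ s"
    using awalk_cyc_decomp_has_prop[of u p v] by auto
  then show ?case using decomp step_awalk_to_apath[of _ p _ q r s] by simp
qed

text \<open>
  Used with \<open>P\<close> for lengths of paths and \<open>Q\<close> for lengths of walks: the minima agree because
  removing cycles turns a walk into a path that is no longer.
\<close>

lemma Least_eq_of_cofinal:
  fixes P Q :: "nat \<Rightarrow> bool"
  assumes PQ: "\<And>l. P l \<Longrightarrow> Q l" and QP: "\<And>l. Q l \<Longrightarrow> \<exists>l'\<le>l. P l'"
  shows "Least P = Least Q"
proof (cases "\<exists>l. Q l")
  case True
  then have "Q (Least Q)" by (rule LeastI_ex)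
  then obtain l where l: "l \<le> Least Q" "P l" using QP by blast
  have "Least P \<le> Least Q" using l by (meson Least_le order_trans)
  moreover have "Least Q \<le> Least P"
    using PQ l(2) by (meson LeastI Least_le)
  ultimately show ?thesis by simp
next
  case False
  then have "P = Q" using PQ by blast
  then show ?thesis by simp
qed

text \<open>
  Powers of the arc relation carry no distinctness condition, so they transfer between a graph and
  its blowup, which paths do not: a path in the blowup may visit several copies of one vertex. The
  equation also holds when \<open>v\<close> cannot be reached from \<open>u\<close>, since then both sides are the least
  element of the empty set.
\<close>

lemma graph_dist_eq_least_relpow:
  assumes "pair_wf_digraph G"
  shows "graph_dist G u v = (LEAST l. u \<in> pverts G \<and> (u, v) \<in> parcs G ^^ l)"
proof -
  interpret pair_wf_digraph G by fact
  let ?P = "\<lambda>l. \<exists>p. apath u p v \<and> length p = l"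
  let ?Q = "\<lambda>l. \<exists>p. awalk u p v \<and> length p = l"
  have PQ: "?Q l" if "?P l" for l
    using that by (auto simp: apath_def)
  have QP: "\<exists>l'\<le>l. ?P l'" if "?Q l" for l
    using that apath_awalk_to_apath length_awalk_to_apath_le by blast
  have "Least ?P = Least ?Q"
    using PQ QP by (rule Least_eq_of_cofinal)
  then show ?thesis
    unfolding graph_dist_def awalk_length_iff_relpow[OF assms] .
qed

lemma graph_dist_commute:
  assumes "pair_graph G" and "u \<in> pverts G" and "v \<in> pverts G"
  shows "graph_dist G u v = graph_dist G v u"
proof -
  interpret pair_graph G by fact
  have "sym (parcs G)"
    using pair_sym_arcs by (simp add: symmetric_def)
  then have rev: "(y, x) \<in> parcs G ^^ l" if "(x, y) \<in> parcs G ^^ l" for x y l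
    using that
  proof (induction l arbitrary: x)
    case (Suc l)
    then obtain z where "(x, z) \<in> parcs G" "(z, y) \<in> parcs G ^^ l"
      by (meson relpow_Suc_D2)
    then show ?case
      using Suc.IH \<open>sym (parcs G)\<close> by (meson relpow_Suc_I symD)
  qed simp
  have "(u, v) \<in> parcs G ^^ l \<longleftrightarrow> (v, u) \<in> parcs G ^^ l" for l
    using rev by blast
  then show ?thesis
    using assms(2,3) by (simp add: graph_dist_eq_least_relpow[OF pair_wf_digraph])
qed

lemma exists_neighbour:
  assumes "pair_graph G" and "Digraph_Component.connected (with_proj G)"
    and "card (pverts G) \<ge> 2" and v: "v \<in> pverts G"
  obtains w where "(v, w) \<in> parcs G" "(w, v) \<in> parcs G"
proof -
  interpret pair_graph G by fact
  obtain u where u: "u \<in> pverts G" "u \<noteq> v"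
    using assms(3) v by (metis card_le_Suc0_iff_eq not_less_eq_eq numeral_2_eq_2 pair_finite_verts)
  have "strongly_connected (with_proj G)"
    using symmetric_connected_imp_strongly_connected pair_sym_arcs assms(2) by blast
  then have "v \<rightarrow>\<^sup>*\<^bsub>with_proj G\<^esub> u"
    using u v by (auto simp: strongly_connected_def)
  then obtain w where "(v, w) \<in> parcs G"
    using u(2) by (cases rule: converse_reachable_cases) auto
  moreover from this have "(w, v) \<in> parcs G"
    using pair_sym_arcs by (auto simp: symmetric_def dest: symD)
  ultimately show ?thesis using that by blast
qed

section \<open>Distances in a blowup\<close>

lemma wf_blowup:
  assumes "pair_wf_digraph G"
  shows "pair_wf_digraph (blowup G n)"
proof -
  interpret pair_wf_digraph G by fact
  show ?thesis
    by unfold_locales (auto simp: blowup_def dest: wellformed')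
qed

lemma relpow_blowup_project:
  "(x, y) \<in> parcs (blowup G n) ^^ l \<Longrightarrow> (fst x, fst y) \<in> parcs G ^^ l"
proof (induction l arbitrary: y)
  case 0
  then show ?case by simp
next
  case (Suc l)
  then show ?case by (fastforce simp: blowup_def intro: relpow_Suc_I)
qed

text \<open>
  The intermediate vertices of the walk are lifted to their copies number 0. The length has to be
  positive, since a walk of length 0 cannot join two different copies of one vertex.
\<close>

lemma relpow_blowup_lift:
  assumes "pair_graph G" and pos: "\<forall>v\<in>pverts G. 0 < n v"
  shows "(v, w) \<in> parcs G ^^ Suc l \<Longrightarrow> i < n v \<Longrightarrow> j < n w \<Longrightarrow>
         ((v, i), (w, j)) \<in> parcs (blowup G n) ^^ Suc l"
proof (induction l arbitrary: v i)
  interpret pair_graph G by fact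
  have arc: "((v, i), (w, j)) \<in> parcs (blowup G n)"
    if "(v, w) \<in> parcs G" "i < n v" "j < n w" for v i w j
    using that pair_no_loops[of "(v, w)"] by (auto simp: blowup_def)
  {
    case 0
    then show ?case by (auto intro: arc)
  next
    case (Suc l)
    from Suc.prems(1) obtain u where u: "(v, u) \<in> parcs G" "(u, w) \<in> parcs G ^^ Suc l"
      by (meson relpow_Suc_D2)
    moreover have "0 < n u"
      using u(1) pos wellformed' by blast
    ultimately show ?case
      using Suc by (blast intro: arc relpow_Suc_I2)
  }
qed

text \<open>
  The matrix \<open>D + 2 I\<close>, where \<open>D\<close> is the distance matrix of \<open>G\<close>. The 2 on the diagonal is the
  distance of two different copies of one vertex.
\<close>

definition shifted_distance :: "'a pair_pre_digraph \<Rightarrow> 'a \<Rightarrow> 'a \<Rightarrow> int" where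
  "shifted_distance G v w = (if v = w then 2 else int (graph_dist G v w))"

lemma distance_matrix_blowup:
  assumes "pair_graph G" and "Digraph_Component.connected (with_proj G)"
    and "card (pverts G) \<ge> 2" and pos: "\<forall>v\<in>pverts G. 0 < n v"
    and x: "x \<in> pverts (blowup G n)" and y: "y \<in> pverts (blowup G n)"
  shows "distance_matrix (blowup G n) x y =
         shifted_distance G (fst x) (fst y) + (if x = y then -2 else 0)"
proof -
  interpret pair_graph G by fact
  obtain v i where xv: "x = (v, i)" "v \<in> pverts G" "i < n v"
    using x by (auto simp: blowup_def)
  obtain w j where yw: "y = (w, j)" "w \<in> pverts G" "j < n w"
    using y by (auto simp: blowup_def)
  have dist: "graph_dist (blowup G n) x y = (LEAST l. (x, y) \<in> parcs (blowup G n) ^^ l)"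
    using x by (simp add: graph_dist_eq_least_relpow[OF wf_blowup[OF pair_wf_digraph]])
  consider "x = y" | "v \<noteq> w" | "v = w" "i \<noteq> j"
    using xv yw by auto
  then show ?thesis
  proof cases
    case 1
    then show ?thesis by (simp add: distance_matrix_def shifted_distance_def)
  next
    case 2
    have walks: "(x, y) \<in> parcs (blowup G n) ^^ l \<longleftrightarrow> (v, w) \<in> parcs G ^^ l" for l
    proof (cases l)
      case 0
      then show ?thesis using 2 xv yw by auto
    next
      case (Suc l)
      then show ?thesis
        using relpow_blowup_project[where x = x and y = y and G = G and n = n]
          relpow_blowup_lift[OF assms(1) pos] xv yw
        by (metis fst_conv)
    qed
    have "graph_dist (blowup G n) x y = graph_dist G v w"
      using xv(2) by (simp add: dist walks graph_dist_eq_least_relpow[OF pair_wf_digraph])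
    then show ?thesis
      using 2 xv yw by (auto simp: distance_matrix_def shifted_distance_def)
  next
    \<comment> \<open>Going to a neighbour and back is a walk of length 2.\<close>
    case 3
    obtain u where u: "(v, u) \<in> parcs G" "(u, v) \<in> parcs G"
      using exists_neighbour[OF assms(1-3) xv(2)] .
    then have "(v, w) \<in> parcs G ^^ Suc 1"
      using 3 by auto
    then have "(x, y) \<in> parcs (blowup G n) ^^ 2"
      using relpow_blowup_lift[OF assms(1) pos] xv yw unfolding numeral_2_eq_2 One_nat_def by blast
    moreover have "2 \<le> l" if l: "(x, y) \<in> parcs (blowup G n) ^^ l" for l
    proof (rule ccontr)
      assume "\<not> 2 \<le> l"
      then have "l = 0 \<or> l = 1" by auto
      then show False
        using l 3 xv yw by (auto simp: blowup_def)
    qed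
    ultimately have "graph_dist (blowup G n) x y = 2"
      unfolding dist by (rule Least_equality)
    then show ?thesis
      using 3 xv yw by (auto simp: distance_matrix_def shifted_distance_def)
  qed
qed

section \<open>Determinants indexed by a finite set\<close>

lemma det_on_cong:
  assumes "\<And>i j. i \<in> S \<Longrightarrow> j \<in> S \<Longrightarrow> A i j = B i j"
  shows "det_on S A = det_on S B"
  unfolding det_on_def
  by (intro sum.cong prod.cong arg_cong2[where f = "(*)"] refl)
    (auto simp: assms permutes_in_image)

lemma det_on_image:
  fixes A :: "'i \<Rightarrow> 'i \<Rightarrow> 'r::comm_ring_1"
  assumes inj: "inj_on f S" and fin: "finite S"
  shows "det_on (f ` S) A = det_on S (\<lambda>i j. A (f i) (f j))"
proof -
  define g where "g = inv_into S f"
  have inj_g: "inj_on g (f ` S)" and bij: "bij_betw f S (f ` S)" and bij': "bij_betw g (f ` S) S"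
    using inj unfolding g_def by (auto simp: bij_betw_def inj_on_inv_into)
  have gf: "g (f x) = x" if "x \<in> S" for x
    using inj that by (simp add: g_def)
  have fg: "f (g y) = y" if "y \<in> f ` S" for y
    using that gf by auto
  have "(\<Prod>i\<in>f ` S. A i (map_permutation S f p i)) = (\<Prod>i\<in>S. A (f i) (f (p i)))"
    if "p permutes S" for p
    using inj by (simp add: prod.reindex map_permutation_apply)
  then have "det_on S (\<lambda>i j. A (f i) (f j)) = det_on (f ` S) A"
    unfolding det_on_def
    by (intro sum.reindex_bij_witness[where j = "map_permutation S f" and i = "map_permutation (f ` S) g"])
      (use bij bij' inj inj_g fin gf fg in \<open>auto simp: sign_map_permutation map_permutation_permutes
         map_permutation_compose_inv dest: map_permutation_permutes[OF bij']\<close>)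
  then show ?thesis ..
qed

text \<open>
  Numbering the index set makes the theory of matrices of variable size available, which supplies
  the vanishing for equal rows and the kernel vectors below.
\<close>

lemma det_on_eq_det_mat:
  assumes "bij_betw f {0..<n} S"
  shows "det_on S A = Determinant.det (mat n n (\<lambda>(i, j). A (f i) (f j)))"
proof -
  have "det_on S A = det_on {0..<n} (\<lambda>i j. A (f i) (f j))"
    using assms by (metis bij_betw_def det_on_image finite_atLeastLessThan)
  also have "\<dots> = Determinant.det (mat n n (\<lambda>(i, j). A (f i) (f j)))"
    unfolding det_on_def
    by (subst det_def') (auto intro!: sum.cong prod.cong simp: permutes_in_image)
  finally show ?thesis .
qed

lemma det_on_equal_rows:
  assumes "finite S" and ab: "a \<in> S" "b \<in> S" "a \<noteq> b"
    and rows: "\<And>j. j \<in> S \<Longrightarrow> A a j = A b j"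
  shows "det_on S A = 0"
proof -
  obtain f where f: "bij_betw f {0..<card S} S"
    using ex_bij_betw_nat_finite[OF assms(1)] by blast
  obtain i j where i: "i < card S" "f i = a" and j: "j < card S" "f j = b"
  proof -
    have "a \<in> f ` {0..<card S}" "b \<in> f ` {0..<card S}"
      using bij_betw_imp_surj_on[OF f] ab by simp_all
    then show ?thesis using that by auto
  qed
  have "f k \<in> S" if "k < card S" for k
    using f that by (auto simp: bij_betw_def)
  then have "Matrix.row (mat (card S) (card S) (\<lambda>(i, j). A (f i) (f j))) i =
        Matrix.row (mat (card S) (card S) (\<lambda>(i, j). A (f i) (f j))) j"
    using i j rows by (intro eq_vecI) auto
  then show ?thesis
    unfolding det_on_eq_det_mat[OF f] using i j ab(3)
    by (intro det_identical_rows[of _ "card S" i j]) auto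
qed

lemma det_on_zero_kernel:
  fixes A :: "'i \<Rightarrow> 'i \<Rightarrow> 'r::idom"
  assumes "finite S" and "det_on S A = 0"
  obtains x where "\<exists>i\<in>S. x i \<noteq> 0" and "\<And>i. i \<in> S \<Longrightarrow> (\<Sum>j\<in>S. A i j * x j) = 0"
proof -
  let ?n = "card S"
  obtain f where f: "bij_betw f {0..<?n} S"
    using ex_bij_betw_nat_finite[OF assms(1)] by blast
  let ?A = "mat ?n ?n (\<lambda>(i, j). A (f i) (f j))"
  obtain y where y: "y \<in> carrier_vec ?n" "y \<noteq> 0\<^sub>v ?n" "?A *\<^sub>v y = 0\<^sub>v ?n"
    using assms(2) det_0_iff_vec_prod_zero[of ?A ?n] unfolding det_on_eq_det_mat[OF f] by auto
  define g where "g = inv_into {0..<?n} f"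
  define x where "x i = vec_index y (g i)" for i
  have gf: "g (f k) = k" if "k < ?n" for k
    using f that by (simp add: g_def bij_betw_def)
  have g: "g i < ?n" "f (g i) = i" if "i \<in> S" for i
    using f that unfolding g_def
    by (metis atLeastLessThan_iff bij_betw_def inv_into_into, metis bij_betw_inv_into_right)
  obtain k where k: "k < ?n" "vec_index y k \<noteq> 0"
    using y(1,2) by (metis carrier_vecD eq_vecI index_zero_vec)
  show ?thesis
  proof
    show "\<exists>i\<in>S. x i \<noteq> 0"
      using f k gf[of k] by (intro bexI[of _ "f k"]) (auto simp: x_def bij_betw_def)
    show "(\<Sum>j\<in>S. A i j * x j) = 0" if "i \<in> S" for i
    proof -
      have "(\<Sum>j\<in>S. A i j * x j) = (\<Sum>l = 0..<?n. A i (f l) * vec_index y l)"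
        using f gf by (subst sum.reindex_bij_betw[OF f, symmetric]) (simp add: x_def)
      also have "\<dots> = vec_index (?A *\<^sub>v y) (g i)"
        using g[OF that] y(1) by (simp add: scalar_prod_def)
      also have "\<dots> = 0"
        using g[OF that] y(3) by simp
      finally show ?thesis .
    qed
  qed
qed

lemma det_on_scale_rows:
  "det_on S (\<lambda>i j. x i * A i j) = prod x S * det_on S A"
  by (simp add: det_on_def prod.distrib sum_distrib_left mult_ac)

lemma det_on_of_int: "det_on S (\<lambda>i j. of_int (A i j)) = of_int (det_on S A)"
  by (simp add: det_on_def)

text \<open>
  Expand every product in the Leibniz formula, letting \<open>S\<close> be the set of rows that contribute their
  entry of \<open>A\<close>. The remaining rows contribute \<open>c\<close> or 0, and their product can be nonzero only for
  permutations that fix every index outside \<open>S\<close>, which are exactly the permutations of \<open>S\<close>.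
\<close>

theorem det_on_add_scalar:
  fixes A :: "'i \<Rightarrow> 'i \<Rightarrow> 'r::comm_ring_1"
  assumes fin: "finite V"
  shows "det_on V (\<lambda>i j. A i j + (if i = j then c else 0)) =
         (\<Sum>S\<in>Pow V. c ^ card (V - S) * det_on S A)"
proof -
  have minor: "(\<Sum>p | p permutes V. of_int (sign p) *
                 ((\<Prod>i\<in>S. A i (p i)) * (\<Prod>i\<in>V - S. if i = p i then c else 0))) =
               c ^ card (V - S) * det_on S A"
    if "S \<subseteq> V" for S
  proof -
    have "(\<Sum>p | p permutes V. of_int (sign p) *
             ((\<Prod>i\<in>S. A i (p i)) * (\<Prod>i\<in>V - S. if i = p i then c else 0))) =
          (\<Sum>p | p permutes S. of_int (sign p) *
             ((\<Prod>i\<in>S. A i (p i)) * (\<Prod>i\<in>V - S. if i = p i then c else 0)))"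
    proof (rule sum.mono_neutral_right)
      show "finite {p. p permutes V}" using fin by (rule finite_permutations)
      show "{p. p permutes S} \<subseteq> {p. p permutes V}"
        using that by (auto intro: permutes_subset)
      show "\<forall>p\<in>{p. p permutes V} - {p. p permutes S}. of_int (sign p) *
             ((\<Prod>i\<in>S. A i (p i)) * (\<Prod>i\<in>V - S. if i = p i then c else 0)) = 0"
      proof
        fix p assume p: "p \<in> {p. p permutes V} - {p. p permutes S}"
        then obtain i where "i \<in> V - S" "p i \<noteq> i"
          using permutes_superset[of p V S] by auto
        then have "(\<Prod>i\<in>V - S. if i = p i then c else 0) = 0"
          using fin by (intro prod_zero) force+
        then show "of_int (sign p) *
             ((\<Prod>i\<in>S. A i (p i)) * (\<Prod>i\<in>V - S. if i = p i then c else 0)) = 0"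
          by simp
      qed
    qed
    also have "\<dots> = (\<Sum>p | p permutes S. c ^ card (V - S) *
                       (of_int (sign p) * (\<Prod>i\<in>S. A i (p i))))"
    proof (rule sum.cong[OF refl])
      fix p assume "p \<in> {p. p permutes S}"
      then have "(\<Prod>i\<in>V - S. if i = p i then c else 0) = (\<Prod>i\<in>V - S. c)"
        by (intro prod.cong) (auto simp: permutes_not_in)
      then show "of_int (sign p) *
             ((\<Prod>i\<in>S. A i (p i)) * (\<Prod>i\<in>V - S. if i = p i then c else 0)) =
           c ^ card (V - S) * (of_int (sign p) * (\<Prod>i\<in>S. A i (p i)))"
        by (simp add: mult_ac)
    qed
    finally show ?thesis
      by (simp add: det_on_def sum_distrib_left)
  qed
  have "det_on V (\<lambda>i j. A i j + (if i = j then c else 0)) =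
        (\<Sum>p | p permutes V. \<Sum>S\<in>Pow V. of_int (sign p) *
           ((\<Prod>i\<in>S. A i (p i)) * (\<Prod>i\<in>V - S. if i = p i then c else 0)))"
    by (simp only: det_on_def prod_add[OF fin] sum_distrib_left)
  also have "\<dots> = (\<Sum>S\<in>Pow V. \<Sum>p | p permutes V. of_int (sign p) *
           ((\<Prod>i\<in>S. A i (p i)) * (\<Prod>i\<in>V - S. if i = p i then c else 0)))"
    by (rule sum.swap)
  also have "\<dots> = (\<Sum>S\<in>Pow V. c ^ card (V - S) * det_on S A)"
    by (intro sum.cong refl minor) auto
  finally show ?thesis .
qed

text \<open>
  A set of copies containing exactly one copy of each vertex in \<open>T\<close> is the graph of a choice
  function, so these sets are counted by the functions in a product set.
\<close>

lemma card_transversals: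
  assumes "T \<subseteq> V" and "finite T"
  shows "card {S \<in> Pow (SIGMA v : V. {..<n v}). inj_on fst S \<and> fst ` S = T} = (\<Prod>v\<in>T. n v)"
proof -
  let ?graph = "\<lambda>f. (\<lambda>v. (v, f v)) ` T"
  have "{S \<in> Pow (SIGMA v : V. {..<n v}). inj_on fst S \<and> fst ` S = T} =
        ?graph ` (\<Pi>\<^sub>E v\<in>T. {..<n v})" (is "?L = ?R")
  proof (intro equalityI subsetI)
    fix S assume S: "S \<in> ?L"
    define f where "f = (\<lambda>v\<in>T. snd (inv_into S fst v))"
    have f: "f v = i" if "(v, i) \<in> S" for v i
      using S that inv_into_f_f[of fst S "(v, i)"] by (force simp: f_def)
    have graph: "S = ?graph f"
    proof (intro equalityI subsetI)
      fix x assume "x \<in> S"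
      moreover obtain v i where "x = (v, i)" by fastforce
      ultimately show "x \<in> ?graph f" using S f[of v i] by force
    next
      fix x assume "x \<in> ?graph f"
      then show "x \<in> S" using S f by auto
    qed
    moreover have "f \<in> (\<Pi>\<^sub>E v\<in>T. {..<n v})"
    proof (rule PiE_I)
      fix v assume "v \<in> T"
      then have "(v, f v) \<in> S" by (subst graph) auto
      then show "f v \<in> {..<n v}" using S by auto
    qed (simp add: f_def)
    ultimately show "S \<in> ?R" by blast
  next
    fix S assume "S \<in> ?R"
    then show "S \<in> ?L"
      using assms(1) by (auto simp: inj_on_def PiE_def Pi_def image_image)
  qed
  moreover have "inj_on ?graph (\<Pi>\<^sub>E v\<in>T. {..<n v})"
  proof (rule inj_onI)
    fix f g assume fg: "f \<in> (\<Pi>\<^sub>E v\<in>T. {..<n v})" "g \<in> (\<Pi>\<^sub>E v\<in>T. {..<n v})" "?graph f = ?graph g"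
    show "f = g"
    proof (rule PiE_ext[OF fg(1,2)])
      fix v assume "v \<in> T"
      then have "(v, f v) \<in> ?graph g" unfolding fg(3)[symmetric] by blast
      then show "f v = g v" by auto
    qed
  qed
  ultimately show ?thesis
    by (simp add: card_image card_PiE[OF assms(2)])
qed

text \<open>
  Both sides are expanded into principal minors. On the left, a set \<open>S\<close> of copies contributes nothing
  if it contains two copies of one vertex, because two rows of the minor are then equal. Otherwise
  its minor is that of \<open>M\<close> on the set \<open>T\<close> of underlying vertices. Each \<open>T\<close> arises from as many \<open>S\<close> as
  there are choices of copies, namely the product of the \<open>n v\<close> over \<open>T\<close>, and this is the factor that
  the scaling of the rows by \<open>n v\<close> produces on the right.
\<close>

theorem det_on_copies:
  fixes M :: "'v \<Rightarrow> 'v \<Rightarrow> 'r::comm_ring_1"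
  assumes fin: "finite V" and pos: "\<forall>v\<in>V. 0 < n v"
  shows "det_on (SIGMA v : V. {..<n v}) (\<lambda>x y. M (fst x) (fst y) + (if x = y then c else 0)) =
         c ^ (\<Sum>v\<in>V. n v - 1) *
         det_on V (\<lambda>v w. of_nat (n v) * M v w + (if v = w then c else 0))"
proof -
  let ?W = "SIGMA v : V. {..<n v}"
  let ?A = "\<lambda>x y. M (fst x) (fst y)"
  have finW: "finite ?W" using fin by auto
  have cardW: "card ?W = (\<Sum>v\<in>V. n v)" using fin by simp
  \<comment> \<open>The power of \<open>c\<close> in front accounts for the copies that exceed one per vertex.\<close>
  have excess: "card ?W = (\<Sum>v\<in>V. n v - 1) + card V"
  proof -
    have "(\<Sum>v\<in>V. n v) = (\<Sum>v\<in>V. (n v - 1) + 1)" using pos by (intro sum.cong) auto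
    then show ?thesis unfolding cardW by (simp only: sum.distrib) simp
  qed
  have zero: "det_on S ?A = 0" if S: "S \<subseteq> ?W" "\<not> inj_on fst S" for S
  proof -
    obtain x y where "x \<in> S" "y \<in> S" "x \<noteq> y" "fst x = fst y"
      using S(2) by (auto simp: inj_on_def)
    then show ?thesis
      using finite_subset[OF S(1) finW] by (intro det_on_equal_rows[of S x y]) auto
  qed
  have fibre: "(\<Sum>S\<in>{S \<in> {S \<in> Pow ?W. inj_on fst S}. fst ` S = T}. c ^ card (?W - S) * det_on S ?A) =
      c ^ (\<Sum>v\<in>V. n v - 1) * (c ^ card (V - T) * ((\<Prod>v\<in>T. of_nat (n v)) * det_on T M))"
    if T: "T \<in> Pow V" for T
  proof -
    have finT: "finite T" using T fin finite_subset by auto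
    have "c ^ card (?W - S) * det_on S ?A =
          c ^ (\<Sum>v\<in>V. n v - 1) * (c ^ card (V - T) * det_on T M)"
      if S: "S \<in> Pow ?W" "inj_on fst S" "fst ` S = T" for S
    proof -
      have finS: "finite S" using S(1) finW finite_subset by auto
      have "card (?W - S) = card ?W - card T"
        using S finS card_image[OF S(2)] by (simp add: card_Diff_subset del: card_SigmaI)
      also have "\<dots> = (\<Sum>v\<in>V. n v - 1) + card (V - T)"
        using excess T finT fin card_mono[of V T] by (auto simp: card_Diff_subset)
      finally have "c ^ card (?W - S) = c ^ (\<Sum>v\<in>V. n v - 1) * c ^ card (V - T)"
        by (simp only: power_add)
      moreover have "det_on S ?A = det_on T M"
        using det_on_image[OF S(2) finS, of M] S(3) by simp
      ultimately show ?thesis by (simp only: mult.assoc)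
    qed
    then have "(\<Sum>S\<in>{S \<in> {S \<in> Pow ?W. inj_on fst S}. fst ` S = T}. c ^ card (?W - S) * det_on S ?A) =
       (\<Sum>S\<in>{S \<in> {S \<in> Pow ?W. inj_on fst S}. fst ` S = T}.
          c ^ (\<Sum>v\<in>V. n v - 1) * (c ^ card (V - T) * det_on T M))"
      by (intro sum.cong) auto
    also have "\<dots> = of_nat (\<Prod>v\<in>T. n v) * (c ^ (\<Sum>v\<in>V. n v - 1) * (c ^ card (V - T) * det_on T M))"
      using card_transversals[of T V n] T finT by (simp add: conj_assoc del: of_nat_prod)
    finally show ?thesis by (simp add: mult_ac)
  qed
  have "det_on ?W (\<lambda>x y. ?A x y + (if x = y then c else 0)) =
        (\<Sum>S\<in>Pow ?W. c ^ card (?W - S) * det_on S ?A)"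
    by (rule det_on_add_scalar[OF finW])
  also have "\<dots> = (\<Sum>S\<in>{S \<in> Pow ?W. inj_on fst S}. c ^ card (?W - S) * det_on S ?A)"
    using finW zero by (intro sum.mono_neutral_right) auto
  also have "\<dots> = (\<Sum>T\<in>Pow V. \<Sum>S\<in>{S \<in> {S \<in> Pow ?W. inj_on fst S}. fst ` S = T}.
                     c ^ card (?W - S) * det_on S ?A)"
    using finW fin by (intro sum.group[symmetric]) auto
  also have "\<dots> = (\<Sum>T\<in>Pow V. c ^ (\<Sum>v\<in>V. n v - 1) *
                     (c ^ card (V - T) * ((\<Prod>v\<in>T. of_nat (n v)) * det_on T M)))"
    by (rule sum.cong[OF refl fibre])
  also have "\<dots> = c ^ (\<Sum>v\<in>V. n v - 1) *
         det_on V (\<lambda>v w. of_nat (n v) * M v w + (if v = w then c else 0))"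
    by (simp add: det_on_add_scalar[OF fin] det_on_scale_rows sum_distrib_left)
  finally show ?thesis .
qed

section \<open>Evaluation of multivariate polynomials\<close>

lemma mvpoly_eval_superset:
  assumes "h 0 = 0" and "finite K" and "Poly_Mapping.keys p \<subseteq> K"
  shows "mvpoly_eval h p x =
    (\<Sum>m\<in>K. h (Poly_Mapping.lookup p m) * (\<Prod>v\<in>Poly_Mapping.keys m. x v ^ Poly_Mapping.lookup m v))"
  unfolding mvpoly_eval_def
  using assms by (intro sum.mono_neutral_left) (auto simp: in_keys_iff)

lemma mvpoly_eval_add:
  assumes "h 0 = 0" and "\<And>a b. h (a + b) = h a + h b"
  shows "mvpoly_eval h (p + q) x = mvpoly_eval h p x + mvpoly_eval h q x"
proof -
  let ?K = "Poly_Mapping.keys p \<union> Poly_Mapping.keys q"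
  have "mvpoly_eval h r x =
      (\<Sum>m\<in>?K. h (Poly_Mapping.lookup r m) * (\<Prod>v\<in>Poly_Mapping.keys m. x v ^ Poly_Mapping.lookup m v))"
    if "r \<in> {p, q, p + q}" for r
    using that keys_add[of p q] assms(1) by (intro mvpoly_eval_superset) auto
  then show ?thesis
    by (simp add: lookup_add assms(2) distrib_right sum.distrib)
qed

lemma mvpoly_eval_single:
  assumes "h 0 = 0"
  shows "mvpoly_eval h (Poly_Mapping.single m c) x =
         h c * (\<Prod>v\<in>Poly_Mapping.keys m. x v ^ Poly_Mapping.lookup m v)"
  using assms by (simp add: mvpoly_eval_def)

lemma mvpoly_eval_sum:
  assumes "h 0 = 0" and "\<And>a b. h (a + b) = h a + h b"
  shows "mvpoly_eval h (\<Sum>i\<in>I. p i) x = (\<Sum>i\<in>I. mvpoly_eval h (p i) x)"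
proof -
  have "mvpoly_eval h 0 x = 0" by (simp add: mvpoly_eval_def)
  then show ?thesis
    by (induction I rule: infinite_finite_induct) (simp_all add: mvpoly_eval_add assms)
qed

lemma mvpoly_eval_map:
  assumes "f 0 = 0" and "h 0 = 0"
  shows "mvpoly_eval h (Poly_Mapping.map f p) x = mvpoly_eval (h \<circ> f) p x"
proof -
  have lookup: "Poly_Mapping.lookup (Poly_Mapping.map f p) m = f (Poly_Mapping.lookup p m)" for m
    using assms(1) by (simp add: Poly_Mapping.map.rep_eq when_def)
  have "Poly_Mapping.keys (Poly_Mapping.map f p) \<subseteq> Poly_Mapping.keys p"
    using assms(1) by (auto simp: in_keys_iff lookup)
  then have "mvpoly_eval h (Poly_Mapping.map f p) x = (\<Sum>m\<in>Poly_Mapping.keys p.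
      h (Poly_Mapping.lookup (Poly_Mapping.map f p) m) *
      (\<Prod>v\<in>Poly_Mapping.keys m. x v ^ Poly_Mapping.lookup m v))"
    using assms by (intro mvpoly_eval_superset) auto
  then show ?thesis
    by (simp add: lookup mvpoly_eval_def)
qed

text \<open>
  Kronecker substitution: with weights \<open>1, B, B\<^sup>2, \<dots>\<close> the weighted sum of exponents below \<open>B\<close> is a
  number whose digits in base \<open>B\<close> are the exponents.
\<close>

lemma separating_weights:
  assumes "finite V"
  shows "\<exists>w :: 'v \<Rightarrow> nat. \<forall>m m'. (\<forall>v\<in>V. m v < B \<and> m' v < B) \<longrightarrow>
           (\<Sum>v\<in>V. w v * m v) = (\<Sum>v\<in>V. w v * m' v) \<longrightarrow> (\<forall>v\<in>V. m v = (m' v :: nat))"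
  using assms
proof (induction V rule: finite_induct)
  case empty
  then show ?case by simp
next
  case (insert a V)
  then obtain w :: "'v \<Rightarrow> nat" where w: "\<And>m m'. (\<forall>v\<in>V. m v < B \<and> m' v < B) \<Longrightarrow>
      (\<Sum>v\<in>V. w v * m v) = (\<Sum>v\<in>V. w v * m' v) \<Longrightarrow> (\<forall>v\<in>V. m v = m' v)"
    by blast
  define w' where "w' v = (if v = a then 1 else B * w v)" for v
  have split: "(\<Sum>v\<in>insert a V. w' v * m v) = m a + B * (\<Sum>v\<in>V. w v * m v)" for m
  proof -
    have "(\<Sum>v\<in>V. w' v * m v) = (\<Sum>v\<in>V. B * (w v * m v))"
      using insert.hyps by (intro sum.cong) (auto simp: w'_def)
    then show ?thesis
      using insert.hyps by (simp add: w'_def sum_distrib_left)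
  qed
  show ?case
  proof (intro exI[of _ w'] allI impI)
    fix m m' assume bound: "\<forall>v\<in>insert a V. m v < B \<and> m' v < B"
      and "(\<Sum>v\<in>insert a V. w' v * m v) = (\<Sum>v\<in>insert a V. w' v * m' v)"
    then have eq: "m a + B * (\<Sum>v\<in>V. w v * m v) = m' a + B * (\<Sum>v\<in>V. w v * m' v)"
      by (simp only: split)
    have "m a < B" "m' a < B" using bound by auto
    then have "m a = (m a + B * (\<Sum>v\<in>V. w v * m v)) mod B"
      and "m' a = (m' a + B * (\<Sum>v\<in>V. w v * m' v)) mod B"
      by simp_all
    then have "m a = m' a" by (metis eq)
    moreover from this have "(\<Sum>v\<in>V. w v * m v) = (\<Sum>v\<in>V. w v * m' v)"
      using eq \<open>m a < B\<close> by simp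
    with bound have "\<forall>v\<in>V. m v = m' v"
      by (intro w) blast+
    ultimately show "\<forall>v\<in>insert a V. m v = m' v"
      by blast
  qed
qed

text \<open>
  Substituting \<open>t\<close> to the power \<open>w v\<close> for the variable \<open>v\<close>, with weights \<open>w\<close> that separate the finitely
  many monomials of \<open>r\<close>, gives a univariate polynomial with the same coefficients. It vanishes at all
  positive integers \<open>t\<close>, hence is zero.
\<close>

lemma mvpoly_zero_if_vanishes:
  fixes r :: "('v, int) mvpoly"
  assumes fin: "finite V" and vars: "mvpoly_vars r \<subseteq> V"
    and zero: "\<And>n :: 'v \<Rightarrow> nat. \<forall>v\<in>V. 0 < n v \<Longrightarrow> mvpoly_eval id r (\<lambda>v. int (n v)) = 0"
  shows "r = 0"
proof -
  let ?K = "Poly_Mapping.keys r"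
  define D where "D = (\<Union>m\<in>?K. Poly_Mapping.lookup m ` V)"
  have "finite D" using fin by (simp add: D_def)
  then obtain B where B: "\<And>m v. m \<in> ?K \<Longrightarrow> v \<in> V \<Longrightarrow> Poly_Mapping.lookup m v < B"
    using finite_nat_set_iff_bounded[of D] by (auto simp: D_def)
  obtain w :: "'v \<Rightarrow> nat" where w: "\<And>m m'. (\<forall>v\<in>V. m v < B \<and> m' v < B) \<Longrightarrow>
      (\<Sum>v\<in>V. w v * m v) = (\<Sum>v\<in>V. w v * m' v) \<Longrightarrow> (\<forall>v\<in>V. m v = m' v)"
    using separating_weights[OF fin, of B] by blast
  define e where "e m = (\<Sum>v\<in>V. w v * Poly_Mapping.lookup m v)" for m
  have keys: "Poly_Mapping.keys m \<subseteq> V" if "m \<in> ?K" for m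
    using vars that by (auto simp: mvpoly_vars_def)
  have inj: "inj_on e ?K"
  proof (rule inj_onI)
    fix m m' assume m: "m \<in> ?K" "m' \<in> ?K" "e m = e m'"
    have eq: "\<forall>v\<in>V. Poly_Mapping.lookup m v = Poly_Mapping.lookup m' v"
      using w[of "Poly_Mapping.lookup m" "Poly_Mapping.lookup m'"] B m by (auto simp: e_def)
    show "m = m'"
    proof (rule poly_mapping_eqI)
      fix v show "Poly_Mapping.lookup m v = Poly_Mapping.lookup m' v"
      proof (cases "v \<in> V")
        case False
        then have "v \<notin> Poly_Mapping.keys m" "v \<notin> Poly_Mapping.keys m'"
          using keys m(1,2) by blast+
        then show ?thesis by (simp add: in_keys_iff)
      qed (use eq in blast)
    qed
  qed
  define f where "f = (\<Sum>m\<in>?K. Polynomial.monom (Poly_Mapping.lookup r m) (e m))"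
  have root: "poly f (int t) = 0" if "0 < t" for t
  proof -
    have "(\<Prod>v\<in>Poly_Mapping.keys m. int (t ^ w v) ^ Poly_Mapping.lookup m v) = int t ^ e m"
      if "m \<in> ?K" for m
    proof -
      have "(\<Prod>v\<in>Poly_Mapping.keys m. int (t ^ w v) ^ Poly_Mapping.lookup m v) =
            (\<Prod>v\<in>V. int (t ^ w v) ^ Poly_Mapping.lookup m v)"
        using fin keys[OF that] by (intro prod.mono_neutral_left) (auto simp: in_keys_iff)
      then show ?thesis by (simp add: e_def power_sum power_mult)
    qed
    then have "poly f (int t) = mvpoly_eval id r (\<lambda>v. int (t ^ w v))"
      by (simp add: f_def poly_sum poly_monom mvpoly_eval_def)
    also have "\<dots> = 0" using \<open>0 < t\<close> by (intro zero) simp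
    finally show ?thesis .
  qed
  have "f = 0"
  proof (rule ccontr)
    assume "f \<noteq> 0"
    then have "finite {z. poly f z = 0}" by (rule poly_roots_finite)
    moreover have "int ` {0<..} \<subseteq> {z. poly f z = 0}" using root by auto
    ultimately have "finite (int ` {0<..})" by (rule rev_finite_subset)
    then show False by (simp add: finite_image_iff infinite_Ioi)
  qed
  have "Poly_Mapping.lookup r m = 0" if m: "m \<in> ?K" for m
  proof -
    have "e m' = e m \<longleftrightarrow> m' = m" if "m' \<in> ?K" for m'
      using inj_on_eq_iff[OF inj that m] .
    then have "Polynomial.coeff f (e m) =
        (\<Sum>m'\<in>?K. if m' = m then Poly_Mapping.lookup r m' else 0)"
      unfolding f_def Polynomial.coeff_sum Polynomial.coeff_monom
      by (intro sum.cong refl) presburger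
    also have "\<dots> = Poly_Mapping.lookup r m" using m by simp
    finally show ?thesis using \<open>f = 0\<close> by simp
  qed
  then show "r = 0" by (metis in_keys_iff keys_eq_empty equals0I)
qed

corollary mvpoly_eqI_positive:
  fixes p q :: "('v, int) mvpoly"
  assumes "finite V" and "mvpoly_vars p \<subseteq> V" and "mvpoly_vars q \<subseteq> V"
    and eq: "\<And>n :: 'v \<Rightarrow> nat. \<forall>v\<in>V. 0 < n v \<Longrightarrow>
           mvpoly_eval id p (\<lambda>v. int (n v)) = mvpoly_eval id q (\<lambda>v. int (n v))"
  shows "p = q"
proof -
  have "p - q = 0"
  proof (rule mvpoly_zero_if_vanishes[OF assms(1)])
    show "mvpoly_vars (p - q) \<subseteq> V"
      using assms(2,3) keys_diff[of p q] unfolding mvpoly_vars_def by blast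
    fix n :: "'v \<Rightarrow> nat" assume "\<forall>v\<in>V. 0 < n v"
    then show "mvpoly_eval id (p - q) (\<lambda>v. int (n v)) = 0"
      using eq[of n] mvpoly_eval_add[of id "p - q" q "\<lambda>v. int (n v)"] by simp
  qed
  then show ?thesis by simp
qed

section \<open>The blowup-polynomial as a sum over principal minors\<close>

definition squarefree_monomial :: "'v set \<Rightarrow> 'v \<Rightarrow>\<^sub>0 nat" where
  "squarefree_monomial S = (\<Sum>v\<in>S. Poly_Mapping.single v 1)"

lemma lookup_squarefree_monomial:
  "finite S \<Longrightarrow> Poly_Mapping.lookup (squarefree_monomial S) v = (if v \<in> S then 1 else 0)"
  by (simp add: squarefree_monomial_def lookup_sum lookup_single when_def)

lemma keys_squarefree_monomial:
  "finite S \<Longrightarrow> Poly_Mapping.keys (squarefree_monomial S) = S"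
  by (auto simp: in_keys_iff lookup_squarefree_monomial split: if_splits)

text \<open>
  The expansion of \<open>det (diag(x) M - 2 I)\<close> into principal minors, with \<open>x\<close> as indeterminates.
\<close>

definition principal_minor_poly :: "'v set \<Rightarrow> ('v \<Rightarrow> 'v \<Rightarrow> int) \<Rightarrow> ('v, int) mvpoly" where
  "principal_minor_poly V M =
     (\<Sum>S\<in>Pow V. Poly_Mapping.single (squarefree_monomial S) ((-2) ^ card (V - S) * det_on S M))"

lemma mvpoly_vars_principal_minor_poly:
  assumes "finite V"
  shows "mvpoly_vars (principal_minor_poly V M) \<subseteq> V"
proof -
  have "Poly_Mapping.keys m \<subseteq> V" if m: "m \<in> Poly_Mapping.keys (principal_minor_poly V M)" for m
  proof -
    let ?term = "\<lambda>S. Poly_Mapping.single (squarefree_monomial S) ((-2) ^ card (V - S) * det_on S M)"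
    have "m \<in> (\<Union>S\<in>Pow V. Poly_Mapping.keys (?term S))"
      using m keys_sum[of ?term "Pow V"] unfolding principal_minor_poly_def by (rule rev_subsetD)
    then obtain S where "S \<in> Pow V" "m \<in> Poly_Mapping.keys (?term S)" by blast
    then have "S \<in> Pow V" "m = squarefree_monomial S"
      by (simp_all only: keys_single singleton_iff empty_iff split: if_splits)
    then show ?thesis
      using finite_subset[of S V] assms by (simp add: keys_squarefree_monomial)
  qed
  then show ?thesis by (auto simp: mvpoly_vars_def)
qed

text \<open>
  The same identity is needed over two rings: over the integers, to recognize the determinants
  that define the blowup-polynomial, and over the complex numbers, to prove stability.
\<close>

lemma mvpoly_eval_principal_minor_poly:
  fixes x :: "'v \<Rightarrow> 'r::comm_ring_1"
  assumes fin: "finite V"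
  shows "mvpoly_eval of_int (principal_minor_poly V M) x =
         det_on V (\<lambda>v w. x v * of_int (M v w) + (if v = w then -2 else 0))"
proof -
  have "mvpoly_eval of_int (principal_minor_poly V M) x =
        (\<Sum>S\<in>Pow V. (-2) ^ card (V - S) * (prod x S * of_int (det_on S M)))"
    unfolding principal_minor_poly_def
  proof (subst mvpoly_eval_sum, goal_cases)
    case 3
    show ?case
    proof (rule sum.cong[OF refl])
      fix S assume "S \<in> Pow V"
      then have "finite S" using fin finite_subset by auto
      then show "mvpoly_eval of_int (Poly_Mapping.single (squarefree_monomial S)
                   ((-2) ^ card (V - S) * det_on S M)) x =
                 (-2) ^ card (V - S) * (prod x S * of_int (det_on S M))"
        by (simp add: mvpoly_eval_single keys_squarefree_monomial lookup_squarefree_monomial mult_ac)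
    qed
  qed simp_all
  then show ?thesis
    by (simp add: det_on_add_scalar[OF fin] det_on_scale_rows det_on_of_int)
qed

theorem blowup_poly_eq:
  assumes G: "pair_graph G" and conn: "Digraph_Component.connected (with_proj G)"
    and card: "card (pverts G) \<ge> 2"
  shows "blowup_poly G = principal_minor_poly (pverts G) (shifted_distance G)"
proof -
  interpret pair_graph G by fact
  let ?V = "pverts G" and ?M = "shifted_distance G"
  let ?q = "principal_minor_poly ?V ?M"
  have det: "det_on (pverts (blowup G n)) (distance_matrix (blowup G n)) =
             (-2) ^ (\<Sum>v\<in>?V. n v - 1) * mvpoly_eval id ?q (\<lambda>v. int (n v))"
    if pos: "\<forall>v\<in>?V. 0 < n v" for n
  proof -
    have verts: "pverts (blowup G n) = (SIGMA v : ?V. {..<n v})"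
      by (simp add: blowup_def)
    have "det_on (pverts (blowup G n)) (distance_matrix (blowup G n)) =
          det_on (SIGMA v : ?V. {..<n v}) (\<lambda>x y. ?M (fst x) (fst y) + (if x = y then -2 else 0))"
      unfolding verts[symmetric] by (intro det_on_cong distance_matrix_blowup[OF G conn card pos])
    also have "\<dots> = (-2) ^ (\<Sum>v\<in>?V. n v - 1) *
        det_on ?V (\<lambda>v w. of_nat (n v) * ?M v w + (if v = w then -2 else 0))"
      by (rule det_on_copies[OF pair_finite_verts pos])
    also have "det_on ?V (\<lambda>v w. of_nat (n v) * ?M v w + (if v = w then -2 else 0)) =
        mvpoly_eval of_int ?q (\<lambda>v. int (n v))"
      using mvpoly_eval_principal_minor_poly[OF pair_finite_verts, of ?M "\<lambda>v. int (n v)"] by simp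
    also have "(of_int :: int \<Rightarrow> int) = id" by auto
    finally show ?thesis .
  qed
  show ?thesis
    unfolding blowup_poly_def
  proof (rule the_equality)
    show "mvpoly_vars ?q \<subseteq> ?V \<and> (\<forall>n. (\<forall>v\<in>?V. 0 < n v) \<longrightarrow>
        det_on (pverts (blowup G n)) (distance_matrix (blowup G n)) =
        (-2) ^ (\<Sum>v\<in>?V. n v - 1) * mvpoly_eval id ?q (\<lambda>v. int (n v)))"
      using det mvpoly_vars_principal_minor_poly[OF pair_finite_verts] by blast
  next
    fix p assume p: "mvpoly_vars p \<subseteq> ?V \<and> (\<forall>n. (\<forall>v\<in>?V. 0 < n v) \<longrightarrow>
        det_on (pverts (blowup G n)) (distance_matrix (blowup G n)) =
        (-2) ^ (\<Sum>v\<in>?V. n v - 1) * mvpoly_eval id p (\<lambda>v. int (n v)))"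
    show "p = ?q"
    proof (rule mvpoly_eqI_positive[OF pair_finite_verts])
      show "mvpoly_vars p \<subseteq> ?V" using p by blast
      show "mvpoly_vars ?q \<subseteq> ?V" by (rule mvpoly_vars_principal_minor_poly[OF pair_finite_verts])
      fix n :: "'a \<Rightarrow> nat" assume pos: "\<forall>v\<in>?V. 0 < n v"
      then have "(-2) ^ (\<Sum>v\<in>?V. n v - 1) * mvpoly_eval id p (\<lambda>v. int (n v)) =
            (-2) ^ (\<Sum>v\<in>?V. n v - 1) * mvpoly_eval id ?q (\<lambda>v. int (n v))"
        using p det[OF pos] by metis
      then show "mvpoly_eval id p (\<lambda>v. int (n v)) = mvpoly_eval id ?q (\<lambda>v. int (n v))"
        by simp
    qed
  qed
qed

section \<open>Stability\<close>

lemma quadratic_form_real: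
  fixes M :: "'v \<Rightarrow> 'v \<Rightarrow> int" and x :: "'v \<Rightarrow> complex"
  assumes sym: "\<And>v w. v \<in> V \<Longrightarrow> w \<in> V \<Longrightarrow> M v w = M w v"
  shows "(\<Sum>v\<in>V. cnj (x v) * (\<Sum>w\<in>V. of_int (M v w) * x w)) \<in> \<real>"
proof -
  let ?Q = "\<Sum>v\<in>V. cnj (x v) * (\<Sum>w\<in>V. of_int (M v w) * x w)"
  have "cnj ?Q = (\<Sum>v\<in>V. \<Sum>w\<in>V. x v * (of_int (M v w) * cnj (x w)))"
    by (simp add: sum_distrib_left)
  also have "\<dots> = (\<Sum>w\<in>V. \<Sum>v\<in>V. x v * (of_int (M v w) * cnj (x w)))"
    by (rule sum.swap)
  also have "\<dots> = ?Q"
    by (auto simp: sum_distrib_left sym mult_ac intro!: sum.cong)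
  finally show ?thesis by (simp add: Reals_cnj_iff)
qed

text \<open>
  The number is \<open>2 |a|\<^sup>2 / z\<close>, and inversion maps the upper half-plane to the lower one.
\<close>

lemma Im_divide_upper_half_plane:
  assumes "0 < Im z"
  shows "Im (cnj a * (2 * a / z)) \<le> 0" and "a \<noteq> 0 \<Longrightarrow> Im (cnj a * (2 * a / z)) < 0"
proof -
  have "cnj a * (2 * a / z) = 2 * (a * cnj a) * inverse z"
    by (simp add: divide_inverse mult_ac)
  also have "\<dots> = of_real (2 * (cmod a)\<^sup>2) * inverse z"
    by (simp only: complex_norm_square[symmetric] of_real_mult of_real_numeral)
  finally have "cnj a * (2 * a / z) = of_real (2 * (cmod a)\<^sup>2) * inverse z" .
  then have "Im (cnj a * (2 * a / z)) = - (2 * (cmod a)\<^sup>2 * (Im z / (cmod z)\<^sup>2))"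
    by (simp add: cmod_power2 del: of_real_mult)
  moreover have "0 < (cmod z)\<^sup>2" using assms by auto
  ultimately show "Im (cnj a * (2 * a / z)) \<le> 0" "a \<noteq> 0 \<Longrightarrow> Im (cnj a * (2 * a / z)) < 0"
    using assms by auto
qed

text \<open>
  The value of the quadratic form of \<open>M\<close> at a kernel vector would be both real and of negative
  imaginary part.
\<close>

theorem det_on_upper_half_plane_nonzero:
  fixes M :: "'v \<Rightarrow> 'v \<Rightarrow> int" and z :: "'v \<Rightarrow> complex"
  assumes fin: "finite V" and sym: "\<And>v w. v \<in> V \<Longrightarrow> w \<in> V \<Longrightarrow> M v w = M w v"
    and pos: "\<And>v. v \<in> V \<Longrightarrow> 0 < Im (z v)"
  shows "det_on V (\<lambda>v w. z v * of_int (M v w) + (if v = w then -2 else 0)) \<noteq> 0"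
proof
  assume "det_on V (\<lambda>v w. z v * of_int (M v w) + (if v = w then -2 else 0)) = 0"
  then obtain x where x: "\<exists>v\<in>V. x v \<noteq> 0"
    and ker: "\<And>v. v \<in> V \<Longrightarrow> (\<Sum>w\<in>V. (z v * of_int (M v w) + (if v = w then -2 else 0)) * x w) = 0"
    using det_on_zero_kernel[OF fin] by blast
  have Mx: "(\<Sum>w\<in>V. of_int (M v w) * x w) = 2 * x v / z v" if v: "v \<in> V" for v
  proof -
    have "z v \<noteq> 0" using pos[OF v] by auto
    have "(\<Sum>w\<in>V. (z v * of_int (M v w) + (if v = w then -2 else 0)) * x w) =
          (\<Sum>w\<in>V. z v * (of_int (M v w) * x w) + (if v = w then -2 * x w else 0))"
      by (intro sum.cong) (auto simp: algebra_simps)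
    also have "\<dots> = z v * (\<Sum>w\<in>V. of_int (M v w) * x w) - 2 * x v"
      using fin v by (simp add: sum.distrib sum_distrib_left)
    finally have "z v * (\<Sum>w\<in>V. of_int (M v w) * x w) = 2 * x v"
      using ker[OF v] by simp
    then show ?thesis using \<open>z v \<noteq> 0\<close> by (simp add: field_simps)
  qed
  have "(\<Sum>v\<in>V. cnj (x v) * (2 * x v / z v)) =
        (\<Sum>v\<in>V. cnj (x v) * (\<Sum>w\<in>V. of_int (M v w) * x w))"
    by (simp add: Mx)
  then have "Im (\<Sum>v\<in>V. cnj (x v) * (2 * x v / z v)) = 0"
    using quadratic_form_real[of V M x] sym by (simp only: complex_is_Real_iff)
  moreover have "(\<Sum>v\<in>V. Im (cnj (x v) * (2 * x v / z v))) < (\<Sum>v\<in>V. 0)"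
    using x pos Im_divide_upper_half_plane by (intro sum_strict_mono_ex1 fin) blast+
  ultimately show False by simp
qed

theorem blowup_poly_stable:
  fixes z :: "'a \<Rightarrow> complex"
  assumes "pair_graph G" and "Digraph_Component.connected (with_proj G)"
    and "card (pverts G) \<ge> 2" and pos: "\<And>v. v \<in> pverts G \<Longrightarrow> 0 < Im (z v)"
  shows "mvpoly_eval of_int (blowup_poly G) z \<noteq> 0"
proof -
  interpret pair_graph G by fact
  show ?thesis
    unfolding blowup_poly_eq[OF assms(1-3)] mvpoly_eval_principal_minor_poly[OF pair_finite_verts]
    using graph_dist_commute[OF assms(1)] pos
    by (intro det_on_upper_half_plane_nonzero pair_finite_verts) (auto simp: shifted_distance_def)
qed

text \<open>
  The univariate blowup-polynomial is the restriction of the multivariate one to the diagonal.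
  Every monomial becomes a power of the single variable with the total degree as exponent.
\<close>

lemma poly_univariate_blowup_poly:
  "poly (map_poly complex_of_real (map_poly real_of_int (univariate_blowup_poly G))) z =
   mvpoly_eval of_int (blowup_poly G) (\<lambda>_. z)"
proof -
  let ?c = "Poly_Mapping.lookup (blowup_poly G)"
  define deg :: "('a \<Rightarrow>\<^sub>0 nat) \<Rightarrow> nat"
    where "deg m = (\<Sum>v\<in>Poly_Mapping.keys m. Poly_Mapping.lookup m v)" for m
  have "univariate_blowup_poly G =
        (\<Sum>m\<in>Poly_Mapping.keys (blowup_poly G). Polynomial.monom (?c m) (deg m))"
    unfolding univariate_blowup_poly_def mvpoly_eval_def
    by (intro sum.cong refl) (simp add: power_sum[symmetric] deg_def monom_altdef)
  then have "map_poly complex_of_real (map_poly real_of_int (univariate_blowup_poly G)) =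
        (\<Sum>m\<in>Poly_Mapping.keys (blowup_poly G). Polynomial.monom (of_int (?c m)) (deg m))"
    by (intro poly_eqI) (simp add: coeff_map_poly Polynomial.coeff_sum if_distrib cong: if_cong)
  then show ?thesis
    by (simp add: poly_sum poly_monom mvpoly_eval_def deg_def power_sum)
qed

theorem theorem2p1:
  fixes G :: "'a pair_pre_digraph"
  assumes "pair_graph G"
    and "Digraph_Component.connected (with_proj G)"
    and "card (pverts G) \<ge> 2"
  shows "real_stable (pverts G) (Poly_Mapping.map real_of_int (blowup_poly G)) \<and>
         real_rooted (map_poly real_of_int (univariate_blowup_poly G))"
proof
  show "real_stable (pverts G) (Poly_Mapping.map real_of_int (blowup_poly G))"
    using blowup_poly_stable[OF assms]
    by (simp add: real_stable_def mvpoly_eval_map o_def)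
  show "real_rooted (map_poly real_of_int (univariate_blowup_poly G))"
    unfolding real_rooted_def
  proof (intro allI impI)
    let ?u = "map_poly real_of_int (univariate_blowup_poly G)"
    have upper: "poly (map_poly complex_of_real ?u) z \<noteq> 0" if "0 < Im z" for z
      unfolding poly_univariate_blowup_poly using that by (intro blowup_poly_stable assms)
    fix z assume z: "poly (map_poly complex_of_real ?u) z = 0"
    then have "poly (map_poly complex_of_real ?u) (cnj z) = 0"
      by (subst real_poly_cnj_root_iff) (simp_all add: coeff_map_poly)
    then have "\<not> 0 < Im z" "\<not> 0 < Im (cnj z)"
      using z upper by blast+
    then have "Im z = 0" by simp
    then show "z \<in> \<real>" by (simp add: complex_is_Real_iff)
  qed
qed

end
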